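(* Let $(\mathcal{X},d)$ be a metric space, let $\mathcal{F}$ be a symmetric set of functions $f:\mathcal{X}\to[-1,1]$, let $P^*$ be a probability measure on $\mathcal{X}$, and let $S=(x_1,\dots,x_n)\in\mathcal{X}^n$ be an i.i.d. sample from $P^*$, with empirical distribution $P^*_n$. Let $\mathcal{G}$ be a set (of generators) such that each $g\in\mathcal{G}$ induces a probability measure $P^g$ on $\mathcal{X}$, let $\pi$ be a (prior) probability measure on $\mathcal{G}$, not depending on $S$, and let $\lambda>0$ and $\delta\in(0,1)$ be real numbers. Let $\mathcal{D}_{\mathcal{F}}(P^*_n,P^g)=\mathbb{E}_{S_g}[d_{\mathcal{F}}(P^*_n,P^g_n)]$. Then: (i) For any probability measure $\rho$ on $\mathcal{G}$ such that $\rho\ll\pi$ and $\pi\ll\rho$, with probability at least $1-\delta$ over the random draw of $S\sim(P^* )^{\otimes n}$, $$\mathbb{E}_{g\sim\rho}\,\mathbb{E}_{S}\big[\mathcal{D}_{\mathcal{F}}(P^*_n,P^g)\big]-\mathbb{E}_{g\sim\rho}\big[\mathcal{D}_{\mathcal{F}}(P^*_n,P^g)\big]\le \frac1\lambda\Big[\mathrm{KL}(\rho\,\|\,\pi)+\log\frac1\delta\Big]+\frac{4\lambda}{n}.$$ (ii) For any probability measure $\rho$ on $\mathcal{G}$ such that $\rho\ll\pi$ and $\pi\ll\rho$, with probability at least $1-\delta$ over the random draw of $S\sim(P^* )^{\otimes n}$ and $g\sim\rho$, $$\mathbb{E}_{S}\big[\mathcal{D}_{\mathcal{F}}(P^*_n,P^g)\big]-\mathcal{D}_{\mathcal{F}}(P^*_n,P^g)\le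 \frac1\lambda\Big[\log\frac{d\rho}{d\pi}(g)+\log\frac1\delta\Big]+\frac{4\lambda}{n}.$$
   Context: A set $\mathcal{F}$ of real-valued functions is symmetric if $f\in\mathcal{F}$ implies $-f\in\mathcal{F}$. For probability measures $P,Q$ on $\mathcal{X}$, the integral probability metric induced by $\mathcal{F}$ is $d_{\mathcal{F}}(P,Q)=\sup_{f\in\mathcal{F}}\left|\int f\,dP-\int f\,dQ\right|$. The empirical distribution of $S=(x_1,\dots,x_n)$ is $P^*_n=\frac1n\sum_{i=1}^n\delta_{x_i}$. For $g\in\mathcal{G}$, $S_g=(\hat x_1,\dots,\hat x_n)\sim(P^g)^{\otimes n}$ is an i.i.d. sample of the same size $n$, independent of $S$, with empirical distribution $P^g_n=\frac1n\sum_{i=1}^n\delta_{\hat x_i}$. The empirical risk $\mathcal{D}_{\mathcal{F}}(P^*_n,P^g)=\mathbb{E}_{S_g}[d_{\mathcal{F}}(P^*_n,P^g_n)]$ is an expectation over $S_g$ only, hence a function of $S$ and $g$. $\mathbb{E}_S$ denotes expectation over $S\sim(P^* )^{\otimes n}$. $\mathrm{KL}(\rho\,\|\,\pi)=\mathbb{E}_{g\sim\rho}[\log\frac{d\rho}{d\pi}(g)]$ is the Kullback–Leibler divergence, $\ll$ denotes absolute continuity, and $\frac{d\rho}{d\pi}$ is the Radon–Nikodym derivative. Convention: $\mathcal{G}$ carries a $\sigma$-algebra, and all quantities whose expectation or probability is taken are understood to be (jointly) measurable in $S$, $S_g$, $g$, with $g\mapsto P^g$ a Markov kernel. *)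

theory Defs
  imports "HOL-Probability.Probability"
begin

definition symmetric_class :: "('x \<Rightarrow> real) set \<Rightarrow> bool" where
  "symmetric_class F \<longleftrightarrow> (\<forall>f\<in>F. (\<lambda>x. - f x) \<in> F)"

text \<open>The supremum is taken in the reals, so it is the intended one when \<open>F\<close> is nonempty and
  uniformly bounded. For empty \<open>F\<close> it is a fixed constant, the same for all \<open>P\<close>, \<open>Q\<close>.\<close>

definition ipm :: "('x \<Rightarrow> real) set \<Rightarrow> 'x measure \<Rightarrow> 'x measure \<Rightarrow> real" where
  "ipm F P Q = (\<Squnion>f\<in>F. \<bar>(\<integral>x. f x \<partial>P) - (\<integral>x. f x \<partial>Q)\<bar>)"

text \<open>A sample of size \<open>n\<close> is a function on the index set \<open>{..<n}\<close>, i.e. a point of the product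
  space \<^term>\<open>Pi\<^sub>M {..<n} (\<lambda>_. P)\<close>. The set function below is the average of the Dirac measures at
  the sample points; for \<open>n = 0\<close> it is the zero measure.\<close>

definition empirical_measure :: "nat \<Rightarrow> (nat \<Rightarrow> 'x::topological_space) \<Rightarrow> 'x measure" where
  "empirical_measure n S =
     measure_of UNIV (sets borel)
       (\<lambda>A. ennreal (1 / real n) * (\<Sum>i<n. emeasure (return borel (S i)) A))"

definition empirical_risk ::
  "('x \<Rightarrow> real) set \<Rightarrow> nat \<Rightarrow> (nat \<Rightarrow> 'x::topological_space) \<Rightarrow> 'x measure \<Rightarrow> real" where
  "empirical_risk F n S Q =
     (\<integral>T. ipm F (empirical_measure n S) (empirical_measure n T) \<partial>(Pi\<^sub>M {..<n} (\<lambda>_. Q)))"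

text \<open>\<^const>\<open>KL_divergence\<close> is a Bochner integral and hence \<open>0\<close> when the log-density is not
  integrable. For probability measures with \<open>\<rho> \<lless> \<pi>\<close> the negative part of \<open>log (d\<rho>/d\<pi>)\<close> is always
  \<open>\<rho>\<close>-integrable, so there non-integrability means that the divergence is \<open>\<infinity>\<close>. Note the argument
  order: \<open>d\<rho>/d\<pi>\<close> is \<^term>\<open>RN_deriv \<pi> \<rho>\<close>, and \<open>\<rho> \<lless> \<pi>\<close> is \<^term>\<open>absolutely_continuous \<pi> \<rho>\<close>.\<close>

definition KL :: "'g measure \<Rightarrow> 'g measure \<Rightarrow> ereal" where
  "KL \<rho> \<pi> =
     (if absolutely_continuous \<pi> \<rho> \<and> integrable \<rho> (entropy_density (exp 1) \<pi> \<rho>)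
      then ereal (KL_divergence (exp 1) \<pi> \<rho>) else \<infinity>)"

lemma entropy_density_exp1:
  "entropy_density (exp 1) \<pi> \<rho> g = ln (enn2real (RN_deriv \<pi> \<rho> g))"
  by (simp add: entropy_density_def log_def)

lemma empirical_measure_eq_distr:
  assumes "0 < n"
  shows "empirical_measure n S = distr (uniform_count_measure {..<n}) borel S"
proof -
  let ?N = "distr (uniform_count_measure {..<n}) borel S"
  have eq: "ennreal (1 / real n) * (\<Sum>i<n. emeasure (return borel (S i)) A) = emeasure ?N A"
    if A: "A \<in> sets borel" for A
  proof -
    have meas: "S \<in> measurable (uniform_count_measure {..<n}) borel"
      by (simp add: measurable_def space_uniform_count_measure sets_uniform_count_measure)
    have "emeasure ?N A = ennreal (real (card (S -` A \<inter> {..<n})) / real n)"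
      using A meas
      by (simp add: emeasure_distr space_uniform_count_measure emeasure_uniform_count_measure)
    also have "(\<Sum>i<n. emeasure (return borel (S i)) A) = ennreal (real (card (S -` A \<inter> {..<n})))"
    proof -
      have "(\<Sum>i<n. emeasure (return borel (S i)) A) = (\<Sum>i<n. ennreal (indicator (S -` A) i))"
        using A by (intro sum.cong) (auto simp: indicator_def)
      also have "\<dots> = ennreal (\<Sum>i<n. indicator (S -` A) i)"
        by (rule sum_ennreal) simp
      finally show ?thesis
        by (simp add: indicator_def sum.If_cases Int_commute vimage_def)
    qed
    ultimately show ?thesis
      by (simp add: ennreal_mult[symmetric])
  qed
  have "empirical_measure n S = measure_of UNIV (sets borel) (emeasure ?N)"
    unfolding empirical_measure_def
    by (rule measure_of_eq) (use eq in \<open>auto simp: sets.sigma_sets_eq[of borel, simplified]\<close>)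
  also have "\<dots> = ?N"
    using measure_of_of_measure[of ?N] by simp
  finally show ?thesis .
qed

lemma prob_space_empirical_measure:
  assumes "0 < n"
  shows "prob_space (empirical_measure n S)"
  unfolding empirical_measure_eq_distr[OF assms]
  using assms
  by (intro prob_space.prob_space_distr prob_space_uniform_count_measure)
     (auto simp: measurable_def space_uniform_count_measure sets_uniform_count_measure)

lemma integral_empirical_measure:
  assumes "0 < n" and "f \<in> borel_measurable borel"
  shows "(\<integral>x. f x \<partial>(empirical_measure n S)) = (\<Sum>i<n. f (S i)) / real n"
proof -
  have "(\<integral>x. f x \<partial>(empirical_measure n S)) = (\<integral>i. f (S i) \<partial>(uniform_count_measure {..<n}))"
    unfolding empirical_measure_eq_distr[OF assms(1)]
    by (rule integral_distr)
       (use assms in \<open>auto simp: measurable_def space_uniform_count_measure sets_uniform_count_measure\<close>)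
  also have "\<dots> = (\<Sum>i<n. f (S i)) / real n"
    unfolding uniform_count_measure_def
    by (subst lebesgue_integral_point_measure_finite)
       (use assms in \<open>auto simp: sum_divide_distrib\<close>)
  finally show ?thesis .
qed

end

theory Submission
  imports Defs
begin

text \<open>Replacing one sample point changes \<open>d\<^sub>F (P*\<^sub>n, P\<^sup>g\<^sub>n)\<close>, and hence the empirical risk of \<open>g\<close>, by at
  most \<open>2/n\<close>. For each fixed \<open>g\<close>, McDiarmid's method therefore bounds the exponential moment of
  \<open>\<lambda>\<close> times the gap \<open>\<Delta> S g\<close> between expected and empirical risk by \<open>exp (\<lambda>\<^sup>2 / (2n))\<close>, well below
  \<open>exp (4\<lambda>\<^sup>2 / n)\<close>. Since \<open>exp (- ln (d\<rho>/d\<pi>))\<close> has \<open>\<rho>\<close>-integral at most \<open>1\<close>, Fubini yields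
  \<open>E\<^sub>S E\<^sub>g exp (\<lambda> \<Delta> S g - ln (d\<rho>/d\<pi>) g - 4\<lambda>\<^sup>2 / n) \<le> 1\<close> for \<open>g \<sim> \<rho>\<close>. Markov's inequality on the
  product space is the disintegrated bound; Jensen's inequality in \<open>g\<close> followed by Markov's
  inequality in \<open>S\<close> is the expected one.\<close>

section \<open>Exponential moments under bounded differences\<close>

text \<open>The induction integrates out one coordinate \<open>i\<close> at a time. With the other
  coordinates fixed, the values of \<open>f\<close> lie in an interval of length \<open>c i\<close>,
  so Hoeffding's lemma contributes the factor exp (l^2 (c i)^2 / 8). The partial mean
  \<open>f'\<close> inherits the bound \<open>B\<close> and the differences \<open>c j\<close>, so
  the induction hypothesis applies to it. Nonnegative integrals make the claim meaningful before the
  exponentials are known to be integrable.\<close>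

lemma mcdiarmid_mgf:
  fixes f :: "('i \<Rightarrow> 'a) \<Rightarrow> real" and c :: "'i \<Rightarrow> real"
  assumes M: "\<And>i. prob_space (M i)" and "finite I" and "0 < l"
    and "f \<in> borel_measurable (Pi\<^sub>M I M)"
    and "\<And>x. x \<in> space (Pi\<^sub>M I M) \<Longrightarrow> \<bar>f x\<bar> \<le> B"
    and "\<And>x i y. \<lbrakk>x \<in> space (Pi\<^sub>M I M); i \<in> I; y \<in> space (M i)\<rbrakk> \<Longrightarrow> \<bar>f (x(i := y)) - f x\<bar> \<le> c i"
  shows "(\<integral>\<^sup>+x. exp (l * (f x - (\<integral>x. f x \<partial>Pi\<^sub>M I M))) \<partial>Pi\<^sub>M I M)
           \<le> exp (l\<^sup>2 * (\<Sum>i\<in>I. (c i)\<^sup>2) / 8)"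
  using assms(2,4-6)
proof (induction I arbitrary: f rule: finite_induct)
  case empty
  then show ?case
    by (simp add: PiM_empty lebesgue_integral_count_space_finite nn_integral_count_space_finite)
next
  case (insert i I)
  note [measurable] = insert.prems(1)
  interpret Mi: prob_space "M i"
    by (rule M)
  interpret iI: prob_space "Pi\<^sub>M (insert i I) M"
    by (intro prob_space_PiM M)
  interpret product_prob_space M I
    unfolding product_prob_space_def product_prob_space_axioms_def product_sigma_finite_def
    using M by (auto intro: prob_space_imp_sigma_finite)
  have upd: "x(i := y) \<in> space (Pi\<^sub>M (insert i I) M)" if "x \<in> space (Pi\<^sub>M I M)" "y \<in> space (M i)" for x y
    using that by (simp add: space_PiM PiE_fun_upd)
  define f' where "f' x = (\<integral>y. f (x(i := y)) \<partial>M i)" for x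
  have [measurable]: "f' \<in> borel_measurable (Pi\<^sub>M I M)"
    unfolding f'_def by measurable
  have int_y: "integrable (M i) (\<lambda>y. f (x(i := y)))" if x: "x \<in> space (Pi\<^sub>M I M)" for x
  proof (rule Mi.integrable_const_bound[where B = B])
    show "AE y in M i. norm (f (x(i := y))) \<le> B"
      using insert.prems(2) upd[OF x] by auto
    show "(\<lambda>y. f (x(i := y))) \<in> borel_measurable (M i)"
      using x by measurable
  qed
  have mean: "(\<integral>x. f x \<partial>Pi\<^sub>M (insert i I) M) = (\<integral>x. f' x \<partial>Pi\<^sub>M I M)"
    unfolding f'_def
  proof (rule product_integral_insert)
    show "integrable (Pi\<^sub>M (insert i I) M) f"
      by (rule iI.integrable_const_bound[where B = B]) (use insert.prems(2) in auto)
  qed (use insert.hyps in auto)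
  let ?m = "\<integral>x. f' x \<partial>Pi\<^sub>M I M"
  have f'_bound: "\<bar>f' x\<bar> \<le> B" if x: "x \<in> space (Pi\<^sub>M I M)" for x
  proof -
    have "\<bar>f' x\<bar> \<le> (\<integral>y. \<bar>f (x(i := y))\<bar> \<partial>M i)"
      unfolding f'_def by (rule integral_abs_bound)
    also have "\<dots> \<le> (\<integral>y. B \<partial>M i)"
      using int_y[OF x] insert.prems(2) upd[OF x] by (intro integral_mono) auto
    finally show ?thesis
      by (simp add: Mi.prob_space)
  qed
  have f'_diff: "\<bar>f' (x(j := z)) - f' x\<bar> \<le> c j"
    if x: "x \<in> space (Pi\<^sub>M I M)" and j: "j \<in> I" and z: "z \<in> space (M j)" for x j z
  proof -
    have x': "x(j := z) \<in> space (Pi\<^sub>M I M)"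
      using PiE_fun_upd[of z "\<lambda>i. space (M i)" j x I] x j z by (simp add: space_PiM insert_absorb)
    have "f' (x(j := z)) - f' x = (\<integral>y. f (x(j := z, i := y)) - f (x(i := y)) \<partial>M i)"
      unfolding f'_def using int_y[OF x] int_y[OF x'] by simp
    also have "\<bar>\<dots>\<bar> \<le> (\<integral>y. \<bar>f (x(j := z, i := y)) - f (x(i := y))\<bar> \<partial>M i)"
      by (rule integral_abs_bound)
    also have "\<dots> \<le> (\<integral>y. c j \<partial>M i)"
    proof (rule integral_mono)
      fix y assume y: "y \<in> space (M i)"
      \<comment> \<open>Since \<open>j\<close> is in \<open>I\<close> and \<open>i\<close> is not,
        the updates commute, and the difference hypothesis applies at the base point
        \<open>x(i := y)\<close>.\<close>
      have swap: "x(j := z, i := y) = x(i := y, j := z)"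
        using j insert.hyps by (auto simp: fun_upd_twist)
      show "\<bar>f (x(j := z, i := y)) - f (x(i := y))\<bar> \<le> c j"
        unfolding swap using insert.prems(3)[OF upd[OF x y] _ z] j by blast
    qed (use int_y[OF x] int_y[OF x'] in auto)
    finally show ?thesis
      by (simp add: Mi.prob_space)
  qed
  have inner: "(\<integral>\<^sup>+y. exp (l * (f (x(i := y)) - f' x)) \<partial>M i) \<le> exp (l\<^sup>2 * (c i)\<^sup>2 / 8)"
    if x: "x \<in> space (Pi\<^sub>M I M)" for x
  proof -
    \<comment> \<open>Only the length of the interval is prescribed, not its position. The infimum
      of the section serves as left end; any two values of the section differ by at most
      \<open>c i\<close>, which yields the right end.\<close>
    define a where "a = (INF y\<in>space (M i). f (x(i := y)))"
    have bdd: "bdd_below ((\<lambda>y. f (x(i := y))) ` space (M i))"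
    proof (rule bdd_belowI2)
      show "- B \<le> f (x(i := y))" if "y \<in> space (M i)" for y
        using insert.prems(2)[OF upd[OF x that]] by linarith
    qed
    have range: "f (x(i := y)) \<in> {a..a + c i}" if y: "y \<in> space (M i)" for y
    proof -
      have "f (x(i := y)) - c i \<le> a"
        unfolding a_def
      proof (rule cINF_greatest)
        fix z assume "z \<in> space (M i)"
        then have "\<bar>f (x(i := y, i := z)) - f (x(i := y))\<bar> \<le> c i"
          using insert.prems(3)[OF upd[OF x y]] by blast
        then show "f (x(i := y)) - c i \<le> f (x(i := z))"
          unfolding fun_upd_upd by linarith
      qed (rule Mi.not_empty)
      moreover have "a \<le> f (x(i := y))"
        unfolding a_def using bdd y by (rule cINF_lower)
      ultimately show ?thesis
        by simp
    qed
    interpret interval_bounded_random_variable "M i" "\<lambda>y. f (x(i := y))" a "a + c i"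
    proof
      show "(\<lambda>y. f (x(i := y))) \<in> borel_measurable (M i)"
        using x by measurable
      show "AE y in M i. f (x(i := y)) \<in> {a..a + c i}"
        using range by auto
    qed
    show ?thesis
      using Hoeffdings_lemma_nn_integral[OF \<open>0 < l\<close>] by (simp add: f'_def)
  qed
  have "(\<integral>\<^sup>+x. exp (l * (f x - ?m)) \<partial>Pi\<^sub>M (insert i I) M)
      = (\<integral>\<^sup>+x. \<integral>\<^sup>+y. exp (l * (f (x(i := y)) - ?m)) \<partial>M i \<partial>Pi\<^sub>M I M)"
    by (intro product_nn_integral_insert) (use insert.hyps in auto)
  \<comment> \<open>Splits f - m into (f - f') + (f' - m); the second summand is constant in
    \<open>y\<close> and leaves the inner integral as a factor.\<close>
  also have "\<dots> = (\<integral>\<^sup>+x. ennreal (exp (l * (f' x - ?m))) *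
                          (\<integral>\<^sup>+y. exp (l * (f (x(i := y)) - f' x)) \<partial>M i) \<partial>Pi\<^sub>M I M)"
  proof (rule nn_integral_cong)
    fix x assume x: "x \<in> space (Pi\<^sub>M I M)"
    have [measurable]: "(\<lambda>y. f (x(i := y))) \<in> borel_measurable (M i)"
      using x by measurable
    show "(\<integral>\<^sup>+y. exp (l * (f (x(i := y)) - ?m)) \<partial>M i)
        = ennreal (exp (l * (f' x - ?m))) * (\<integral>\<^sup>+y. exp (l * (f (x(i := y)) - f' x)) \<partial>M i)"
      by (subst nn_integral_cmult[symmetric])
         (auto intro!: nn_integral_cong simp: algebra_simps simp flip: ennreal_mult exp_add)
  qed
  also have "\<dots> \<le> (\<integral>\<^sup>+x. ennreal (exp (l * (f' x - ?m))) * ennreal (exp (l\<^sup>2 * (c i)\<^sup>2 / 8)) \<partial>Pi\<^sub>M I M)"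
    by (intro nn_integral_mono mult_left_mono inner) auto
  also have "\<dots> = (\<integral>\<^sup>+x. exp (l * (f' x - ?m)) \<partial>Pi\<^sub>M I M) * ennreal (exp (l\<^sup>2 * (c i)\<^sup>2 / 8))"
    by (rule nn_integral_multc) measurable
  also have "\<dots> \<le> ennreal (exp (l\<^sup>2 * (\<Sum>i\<in>I. (c i)\<^sup>2) / 8)) * ennreal (exp (l\<^sup>2 * (c i)\<^sup>2 / 8))"
    by (intro mult_right_mono insert.IH f'_bound f'_diff) auto
  also have "\<dots> = exp (l\<^sup>2 * (\<Sum>i\<in>insert i I. (c i)\<^sup>2) / 8)"
    using insert.hyps by (simp add: field_simps flip: ennreal_mult exp_add)
  finally show ?case
    unfolding mean .
qed

section \<open>Finite products of probability kernels\<close>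

text \<open>Boxes form an intersection-stable generator of the product sigma-algebra, and on a box
  the product measure is a finite product of kernel values, each measurable in \<open>x\<close>.
  This makes the law of the generated sample a kernel in the generator.\<close>

lemma measurable_PiM_kernel:
  assumes "finite I" and K: "\<And>i. i \<in> I \<Longrightarrow> K i \<in> M \<rightarrow>\<^sub>M prob_algebra (N i)"
  shows "(\<lambda>x. Pi\<^sub>M I (\<lambda>i. K i x)) \<in> M \<rightarrow>\<^sub>M prob_algebra (Pi\<^sub>M I N)"
proof (rule measurable_prob_algebra_generated
    [where \<Omega> = "\<Pi>\<^sub>E i\<in>I. space (N i)" and G = "{Pi\<^sub>E I E | E. \<forall>i\<in>I. E i \<in> sets (N i)}"])
  have prob: "prob_space (K i x)" and sets_K: "sets (K i x) = sets (N i)"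
    if "x \<in> space M" "i \<in> I" for x i
    using measurable_space[OF K[OF that(2)] that(1)] by (auto simp: space_prob_algebra)
  show "sets (Pi\<^sub>M I N) = sigma_sets (\<Pi>\<^sub>E i\<in>I. space (N i)) {Pi\<^sub>E I E | E. \<forall>i\<in>I. E i \<in> sets (N i)}"
    unfolding sets_PiM by (subst prod_algebra_eq_finite) (auto simp: assms Pi_iff)
  show "Int_stable {Pi\<^sub>E I E | E. \<forall>i\<in>I. E i \<in> sets (N i)}"
    by (rule Int_stable_PiE)
  show "{Pi\<^sub>E I E | E. \<forall>i\<in>I. E i \<in> sets (N i)} \<subseteq> Pow (\<Pi>\<^sub>E i\<in>I. space (N i))"
    using sets.sets_into_space by (blast intro: PiE_mono)
  show "prob_space (Pi\<^sub>M I (\<lambda>i. K i x))" if "x \<in> space M" for x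
    using prob[OF that] by (rule prob_space_PiM)
  show "sets (Pi\<^sub>M I (\<lambda>i. K i x)) = sets (Pi\<^sub>M I N)" if "x \<in> space M" for x
    using sets_K[OF that] by (intro sets_PiM_cong) auto
  fix A assume "A \<in> {Pi\<^sub>E I E | E. \<forall>i\<in>I. E i \<in> sets (N i)}"
  then obtain E where A: "A = Pi\<^sub>E I E" and E: "\<And>i. i \<in> I \<Longrightarrow> E i \<in> sets (N i)"
    by auto
  have "emeasure (Pi\<^sub>M I (\<lambda>i. K i x)) A = (\<Prod>i\<in>I. emeasure (K i x) (E i))" if x: "x \<in> space M" for x
  proof -
    have "A = prod_emb I (\<lambda>i. K i x) I (Pi\<^sub>E I E)"
      unfolding A
      by (rule prod_emb_PiE_same_index[symmetric])
         (use E sets_K[OF x] sets.sets_into_space in blast)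
    then show ?thesis
      using E sets_K[OF x] prob[OF x] \<open>finite I\<close>
      by (simp add: emeasure_PiM_emb)
  qed
  moreover have "(\<lambda>x. \<Prod>i\<in>I. emeasure (K i x) (E i)) \<in> borel_measurable M"
    by (intro borel_measurable_prod_ennreal measurable_emeasure_kernel[OF measurable_prob_algebraD[OF K]] E)
  ultimately show "(\<lambda>x. emeasure (Pi\<^sub>M I (\<lambda>i. K i x)) A) \<in> borel_measurable M"
    by (simp cong: measurable_cong)
qed

section \<open>Markov's inequality, Jensen's inequality and change of measure\<close>

text \<open>Markov's inequality for exp X at level 1 / \<delta>: exceeding
  \<open>ln (1 / \<delta>)\<close> forces exp X above 1 / \<delta>, which has probability at most
  \<delta>.\<close>

lemma (in prob_space) exp_moment_le_one_tail:
  fixes X :: "'a \<Rightarrow> real"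
  assumes [measurable]: "X \<in> borel_measurable M"
    and le1: "(\<integral>\<^sup>+x. exp (X x) \<partial>M) \<le> 1" and "0 < \<delta>"
  shows "\<P>(x in M. X x \<le> ln (1 / \<delta>)) \<ge> 1 - \<delta>"
proof -
  have "emeasure M {x\<in>space M. \<not> X x \<le> ln (1 / \<delta>)}
      \<le> emeasure M {x\<in>space M. 1 \<le> ennreal \<delta> * ennreal (exp (X x))}"
  proof (intro emeasure_mono subsetI CollectI conjI)
    fix x assume x: "x \<in> {x\<in>space M. \<not> X x \<le> ln (1 / \<delta>)}"
    then have "exp (ln (1 / \<delta>)) < exp (X x)"
      by simp
    then have "1 / \<delta> < exp (X x)"
      using \<open>0 < \<delta>\<close> by simp
    then show "1 \<le> ennreal \<delta> * ennreal (exp (X x))"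
      using \<open>0 < \<delta>\<close> by (simp add: field_simps flip: ennreal_mult)
  qed auto
  also have "\<dots> \<le> ennreal \<delta> * (\<integral>\<^sup>+x. ennreal (exp (X x)) * indicator (space M) x \<partial>M)"
    by (rule nn_integral_Markov_inequality) auto
  also have "(\<integral>\<^sup>+x. ennreal (exp (X x)) * indicator (space M) x \<partial>M) = (\<integral>\<^sup>+x. exp (X x) \<partial>M)"
    by (intro nn_integral_cong) simp
  also have "ennreal \<delta> * \<dots> \<le> ennreal \<delta>"
    using mult_left_mono[OF le1, of "ennreal \<delta>"] by simp
  finally have "\<P>(x in M. \<not> X x \<le> ln (1 / \<delta>)) \<le> \<delta>"
    using \<open>0 < \<delta>\<close> by (simp add: emeasure_eq_measure)
  then show ?thesis
    by (subst (asm) prob_neg) auto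
qed

text \<open>Jensen's inequality for exp with a right side that may be infinite, so that only
  \<open>X\<close> itself has to be integrable.\<close>

lemma (in prob_space) exp_integral_le_nn_integral_exp:
  assumes X: "integrable M X"
  shows "ennreal (exp (\<integral>x. X x \<partial>M)) \<le> (\<integral>\<^sup>+x. exp (X x) \<partial>M)"
proof (cases "integrable M (\<lambda>x. exp (X x))")
  case True
  then have "exp (\<integral>x. X x \<partial>M) \<le> (\<integral>x. exp (X x) \<partial>M)"
    using convex_on_exp[of 1] X by (intro jensens_inequality[where I = UNIV]) auto
  then show ?thesis
    using True by (simp add: nn_integral_eq_integral)
next
  case False
  then have "(\<integral>\<^sup>+x. exp (X x) \<partial>M) = \<infinity>"
    using X by (auto simp: integrable_iff_bounded less_top[symmetric] dest: borel_measurable_integrable)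
  then show ?thesis
    by simp
qed

text \<open>Passing from \<rho> to \<pi> multiplies the integrand by the density r, and r exp (- ln
  r) is 1 where r is positive and 0 where r vanishes.\<close>

lemma nn_integral_exp_neg_ln_RN_deriv_le_one:
  assumes "prob_space \<pi>" "prob_space \<rho>" and sets: "sets \<rho> = sets \<pi>"
    and ac: "absolutely_continuous \<pi> \<rho>"
  shows "(\<integral>\<^sup>+g. exp (- ln (enn2real (RN_deriv \<pi> \<rho> g))) \<partial>\<rho>) \<le> 1"
proof -
  interpret \<pi>: prob_space \<pi> by fact
  interpret \<rho>: prob_space \<rho> by fact
  let ?r = "RN_deriv \<pi> \<rho>"
  have "(\<integral>\<^sup>+g. exp (- ln (enn2real (?r g))) \<partial>\<rho>) = (\<integral>\<^sup>+g. ?r g * exp (- ln (enn2real (?r g))) \<partial>\<pi>)"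
    by (rule \<pi>.RN_deriv_nn_integral[OF ac sets]) measurable
  also have "\<dots> \<le> (\<integral>\<^sup>+g. 1 \<partial>\<pi>)"
  proof (rule nn_integral_mono_AE)
    have "AE g in \<pi>. ?r g \<noteq> \<infinity>"
      by (rule \<pi>.RN_deriv_finite[OF \<rho>.sigma_finite_measure_axioms ac sets])
    then show "AE g in \<pi>. ?r g * ennreal (exp (- ln (enn2real (?r g)))) \<le> 1"
    proof eventually_elim
      case (elim g)
      then obtain t where t: "0 \<le> t" "?r g = ennreal t"
        by (cases "?r g") auto
      \<comment> \<open>At \<open>t = 0\<close> the factor \<open>t\<close> annihilates the product,
        whatever value \<open>ln 0\<close> has.\<close>
      then show ?case
        by (cases "t = 0") (auto simp: exp_minus simp flip: ennreal_mult)
    qed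
  qed
  finally show ?thesis
    by (simp add: \<pi>.emeasure_space_1)
qed

section \<open>PAC-Bayes bounds from an exponential moment bound for each generator\<close>

context
  fixes \<mu> :: "'s measure" and \<pi> \<rho> :: "'g measure" and \<Delta> :: "'s \<Rightarrow> 'g \<Rightarrow> real" and l K B \<delta> :: real
  assumes \<mu>: "prob_space \<mu>" and \<pi>: "prob_space \<pi>" and \<rho>: "prob_space \<rho>"
    and sets_eq: "sets \<rho> = sets \<pi>" and ac: "absolutely_continuous \<pi> \<rho>"
    and \<Delta>_measurable: "(\<lambda>(s, g). \<Delta> s g) \<in> borel_measurable (\<mu> \<Otimes>\<^sub>M \<rho>)"
    and l: "0 < l" and \<delta>: "0 < \<delta>"
    and mgf: "\<And>g. g \<in> space \<rho> \<Longrightarrow> (\<integral>\<^sup>+s. exp (l * \<Delta> s g) \<partial>\<mu>) \<le> exp K"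
begin

interpretation \<mu>: prob_space \<mu> by (rule \<mu>)
interpretation \<pi>: prob_space \<pi> by (rule \<pi>)
interpretation \<rho>: prob_space \<rho> by (rule \<rho>)
interpretation pair_prob_space \<mu> \<rho> ..

text \<open>The gap scaled by \<open>l\<close>, penalised by the log-density and by the constant
  \<open>K\<close>, so that its exponential moment is at most 1. Solving
  \<open>X \<le> ln (1 / \<delta>)\<close> for the gap gives the right sides of both bounds, with
  remainder \<open>K / l\<close>.\<close>

private definition X :: "'s \<times> 'g \<Rightarrow> real" where
  "X = (\<lambda>(s, g). l * \<Delta> s g - ln (enn2real (RN_deriv \<pi> \<rho> g)) - K)"

private lemma RN_deriv_measurable: "RN_deriv \<pi> \<rho> \<in> borel_measurable \<rho>"
  using borel_measurable_RN_deriv[of \<pi> \<rho>] sets_eq by (simp cong: measurable_cong_sets)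

private lemma X_measurable: "X \<in> borel_measurable (\<mu> \<Otimes>\<^sub>M \<rho>)"
proof -
  note [measurable] = \<Delta>_measurable RN_deriv_measurable
  show ?thesis
    unfolding X_def by measurable
qed

private lemma exp_moment_X: "(\<integral>\<^sup>+z. exp (X z) \<partial>(\<mu> \<Otimes>\<^sub>M \<rho>)) \<le> 1"
proof -
  note [measurable] = \<Delta>_measurable RN_deriv_measurable X_measurable
  let ?r = "\<lambda>g. enn2real (RN_deriv \<pi> \<rho> g)"
  \<comment> \<open>The sample is integrated first, because \<open>mgf\<close> is available for each
    fixed \<open>g\<close>; \<rho> does not depend on the sample, so Fubini permits this
    order.\<close>
  have "(\<integral>\<^sup>+z. exp (X z) \<partial>(\<mu> \<Otimes>\<^sub>M \<rho>)) = (\<integral>\<^sup>+g. \<integral>\<^sup>+s. exp (X (s, g)) \<partial>\<mu> \<partial>\<rho>)"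
    by (rule nn_integral_snd[symmetric]) measurable
  also have "\<dots> \<le> (\<integral>\<^sup>+g. exp (- ln (?r g)) \<partial>\<rho>)"
  proof (rule nn_integral_mono)
    fix g assume g: "g \<in> space \<rho>"
    have [measurable]: "(\<lambda>s. \<Delta> s g) \<in> borel_measurable \<mu>"
      using measurable_compose[OF measurable_Pair2'[OF g] \<Delta>_measurable] by simp
    have "(\<integral>\<^sup>+s. exp (X (s, g)) \<partial>\<mu>) = (\<integral>\<^sup>+s. ennreal (exp (l * \<Delta> s g)) * ennreal (exp (- ln (?r g) - K)) \<partial>\<mu>)"
      by (intro nn_integral_cong) (simp add: X_def algebra_simps flip: ennreal_mult exp_add)
    also have "\<dots> = (\<integral>\<^sup>+s. exp (l * \<Delta> s g) \<partial>\<mu>) * ennreal (exp (- ln (?r g) - K))"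
      by (rule nn_integral_multc) measurable
    also have "\<dots> \<le> ennreal (exp K) * ennreal (exp (- ln (?r g) - K))"
      by (intro mult_right_mono mgf g) auto
    also have "\<dots> = exp (- ln (?r g))"
      by (simp flip: ennreal_mult exp_add)
    finally show "(\<integral>\<^sup>+s. exp (X (s, g)) \<partial>\<mu>) \<le> exp (- ln (?r g))" .
  qed
  also have "\<dots> \<le> 1"
    by (rule nn_integral_exp_neg_ln_RN_deriv_le_one[OF \<pi> \<rho> sets_eq ac])
  finally show ?thesis .
qed

text \<open>The tail bound for \<open>X\<close> under the joint law of \<open>s\<close> and
  \<open>g\<close>, rearranged by dividing by \<open>l\<close>.\<close>

lemma pac_bayes_disintegrated:
  "\<P>((s, g) in \<mu> \<Otimes>\<^sub>M \<rho>.
      \<Delta> s g \<le> 1 / l * (ln (enn2real (RN_deriv \<pi> \<rho> g)) + ln (1 / \<delta>)) + K / l) \<ge> 1 - \<delta>"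
proof -
  have "1 - \<delta> \<le> \<P>(z in \<mu> \<Otimes>\<^sub>M \<rho>. X z \<le> ln (1 / \<delta>))"
    by (rule P.exp_moment_le_one_tail[OF X_measurable exp_moment_X \<delta>])
  also have "{z \<in> space (\<mu> \<Otimes>\<^sub>M \<rho>). X z \<le> ln (1 / \<delta>)} = {(s, g). (s, g) \<in> space (\<mu> \<Otimes>\<^sub>M \<rho>) \<and>
      \<Delta> s g \<le> 1 / l * (ln (enn2real (RN_deriv \<pi> \<rho> g)) + ln (1 / \<delta>)) + K / l}"
    using l by (auto simp: X_def field_simps)
  finally show ?thesis .
qed

text \<open>Jensen's inequality in \<open>g\<close> is applied at each fixed \<open>s\<close>; the
  mean of \<open>X\<close> over \<rho> then has exponential moment at most 1 under \<mu>, and its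
  log-density term is the divergence.\<close>

lemma pac_bayes_expected:
  assumes bound: "\<And>s g. \<lbrakk>s \<in> space \<mu>; g \<in> space \<rho>\<rbrakk> \<Longrightarrow> \<bar>\<Delta> s g\<bar> \<le> B"
  shows "\<P>(s in \<mu>. ereal (\<integral>g. \<Delta> s g \<partial>\<rho>)
      \<le> ereal (1 / l) * (KL \<rho> \<pi> + ereal (ln (1 / \<delta>))) + ereal (K / l)) \<ge> 1 - \<delta>"
proof (cases "integrable \<rho> (entropy_density (exp 1) \<pi> \<rho>)")
  \<comment> \<open>An infinite divergence makes the right side infinite, since \<open>l\<close> is
    positive; the event is then the whole space.\<close>
  case False
  then have "KL \<rho> \<pi> = \<infinity>"
    by (simp add: KL_def)
  then show ?thesis
    using l \<delta> by (simp add: \<mu>.prob_space)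
next
  case True
  note [measurable] = \<Delta>_measurable X_measurable
  let ?d = "\<lambda>g. ln (enn2real (RN_deriv \<pi> \<rho> g))"
  define kl where "kl = (\<integral>g. ?d g \<partial>\<rho>)"
  have d: "integrable \<rho> ?d"
    using True by (simp add: entropy_density_exp1[abs_def])
  have KL: "KL \<rho> \<pi> = ereal kl"
    using True ac by (simp add: KL_def KL_divergence_def entropy_density_exp1[abs_def] kl_def)
  have \<Delta>_integrable: "integrable \<rho> (\<Delta> s)" if s: "s \<in> space \<mu>" for s
  proof (rule \<rho>.integrable_const_bound[where B = B])
    show "\<Delta> s \<in> borel_measurable \<rho>"
      using measurable_compose[OF measurable_Pair1'[OF s] \<Delta>_measurable] by simp
  qed (use bound s in auto)
  let ?Y = "\<lambda>s. \<integral>g. X (s, g) \<partial>\<rho>"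
  have Y: "?Y s = l * (\<integral>g. \<Delta> s g \<partial>\<rho>) - kl - K" if "s \<in> space \<mu>" for s
    unfolding X_def kl_def using \<Delta>_integrable[OF that] d by (simp add: \<rho>.prob_space)
  have "(\<integral>\<^sup>+s. exp (?Y s) \<partial>\<mu>) \<le> (\<integral>\<^sup>+s. \<integral>\<^sup>+g. exp (X (s, g)) \<partial>\<rho> \<partial>\<mu>)"
  proof (rule nn_integral_mono)
    fix s assume "s \<in> space \<mu>"
    then show "ennreal (exp (?Y s)) \<le> (\<integral>\<^sup>+g. exp (X (s, g)) \<partial>\<rho>)"
      using \<Delta>_integrable d by (intro \<rho>.exp_integral_le_nn_integral_exp) (simp add: X_def)
  qed
  also have "\<dots> = (\<integral>\<^sup>+z. exp (X z) \<partial>(\<mu> \<Otimes>\<^sub>M \<rho>))"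
    by (rule \<rho>.nn_integral_fst) measurable
  also have "\<dots> \<le> 1"
    by (rule exp_moment_X)
  finally have "1 - \<delta> \<le> \<P>(s in \<mu>. ?Y s \<le> ln (1 / \<delta>))"
    using \<delta> by (intro \<mu>.exp_moment_le_one_tail) measurable
  also have "{s\<in>space \<mu>. ?Y s \<le> ln (1 / \<delta>)} = {s\<in>space \<mu>. ereal (\<integral>g. \<Delta> s g \<partial>\<rho>)
      \<le> ereal (1 / l) * (KL \<rho> \<pi> + ereal (ln (1 / \<delta>))) + ereal (K / l)}"
    using l by (auto simp: Y KL field_simps)
  finally show ?thesis .
qed

end

section \<open>Integral probability metrics between empirical measures\<close>

lemma ipm_empirical:
  assumes "\<forall>f\<in>F. f \<in> borel_measurable borel" "0 < n"
  shows "ipm F (empirical_measure n S) (empirical_measure n T)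
           = (\<Squnion>f\<in>F. \<bar>(\<Sum>i<n. f (S i)) / real n - (\<Sum>i<n. f (T i)) / real n\<bar>)"
  unfolding ipm_def using assms by (intro arg_cong[where f = Sup] image_cong) (auto simp: integral_empirical_measure)

lemma abs_mean_diff_le:
  fixes f :: "'x \<Rightarrow> real"
  assumes "\<forall>x. f x \<in> {-1..1}"
  shows "\<bar>(\<Sum>i<n. f (S i)) / real n - (\<Sum>i<n. f (T i)) / real n\<bar> \<le> 2"
proof (cases "n = 0")
  case False
  have "\<bar>f (S i) - f (T i)\<bar> \<le> 2" for i
    using assms[rule_format, of "S i"] assms[rule_format, of "T i"] by auto
  then have "\<bar>\<Sum>i<n. f (S i) - f (T i)\<bar> \<le> (\<Sum>i<n. 2)"
    by (intro order.trans[OF sum_abs] sum_mono)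
  then show ?thesis
    using False by (simp add: sum_subtractf field_simps flip: diff_divide_distrib)
qed simp

text \<open>The bound 2 works for nonempty \<open>F\<close>. For empty \<open>F\<close> the metric
  is the supremum of the empty set, a fixed real of unspecified value, hence the existential
  form.\<close>

lemma ipm_empirical_bounded:
  fixes F :: "('x::topological_space \<Rightarrow> real) set"
  assumes F: "\<forall>f\<in>F. \<forall>x. f x \<in> {-1..1}" and meas: "\<forall>f\<in>F. f \<in> borel_measurable borel" and n: "0 < n"
  shows "\<exists>B. \<forall>S T. \<bar>ipm F (empirical_measure n S) (empirical_measure n T)\<bar> \<le> B"
proof (cases "F = {}")
  case True
  then show ?thesis
    by (auto simp: ipm_def)
next
  case False
  have "\<bar>(\<Sum>i<n. f (S i)) / real n - (\<Sum>i<n. f (T i)) / real n\<bar> \<le> 2" if "f \<in> F" for f S T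
    using F that by (blast intro: abs_mean_diff_le)
  then show ?thesis
    unfolding ipm_empirical[OF meas n] using False
    by (intro exI[of _ 2] allI cSup_abs_le) auto
qed

text \<open>Moving one point changes each sample mean by at most 2 / n, because values lie in
  [-1, 1], and a supremum moves no further than its members.\<close>

lemma ipm_empirical_update:
  fixes F :: "('x::topological_space \<Rightarrow> real) set"
  assumes F: "\<forall>f\<in>F. \<forall>x. f x \<in> {-1..1}" and meas: "\<forall>f\<in>F. f \<in> borel_measurable borel" and n: "0 < n"
  shows "\<bar>ipm F (empirical_measure n (S(i := y))) (empirical_measure n T)
            - ipm F (empirical_measure n S) (empirical_measure n T)\<bar> \<le> 2 / real n"
proof (cases "F = {}")
  case True
  then show ?thesis
    by (simp add: ipm_def)
next
  case False
  let ?D = "\<lambda>S. ipm F (empirical_measure n S) (empirical_measure n T)"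
  let ?d = "\<lambda>S f. \<bar>(\<Sum>i<n. f (S i)) / real n - (\<Sum>i<n. f (T i)) / real n\<bar>"
  have one_sided: "?D (S(i := y)) \<le> ?D S + 2 / real n" for S y
    unfolding ipm_empirical[OF meas n]
  proof (rule cSUP_least[OF False])
    fix f assume f: "f \<in> F"
    have "\<bar>(\<Sum>j<n. f ((S(i := y)) j)) - (\<Sum>j<n. f (S j))\<bar> \<le> 2"
    \<comment> \<open>For \<open>i \<ge> n\<close> the update lies outside the sample and both sums
      agree.\<close>
    proof (cases "i < n")
      case True
      then have "(\<Sum>j<n. f ((S(i := y)) j)) - (\<Sum>j<n. f (S j)) = f y - f (S i)"
        by (simp add: sum.remove[of "{..<n}" i])
      moreover have "f y \<in> {-1..1}" "f (S i) \<in> {-1..1}"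
        using F f by auto
      ultimately show ?thesis
        by (auto simp: abs_le_iff)
    qed simp
    then have "\<bar>(\<Sum>j<n. f ((S(i := y)) j)) / real n - (\<Sum>j<n. f (S j)) / real n\<bar> \<le> 2 / real n"
      using n by (simp add: divide_right_mono flip: diff_divide_distrib)
    then have "?d (S(i := y)) f \<le> ?d S f + 2 / real n"
      by linarith
    also have "?d S f \<le> (\<Squnion>f\<in>F. ?d S f)"
      using F f by (intro cSUP_upper bdd_aboveI2[where M = 2] abs_mean_diff_le) blast+
    finally show "?d (S(i := y)) f \<le> (\<Squnion>f\<in>F. ?d S f) + 2 / real n"
      by simp
  qed
  \<comment> \<open>The second instance restores the old value \<open>S i\<close>, which gives the
    reverse inequality.\<close>
  show ?thesis
    using one_sided[of S y] one_sided[of "S(i := y)" "S i"] by simp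
qed

section \<open>Measurability of the empirical risk\<close>

text \<open>Pushing \<open>L x\<close> forward along y -> (x, y) gives a kernel into the product
  space, where the integrand no longer depends on the parameter.\<close>

lemma integral_measurable_subprob_algebra2:
  fixes f :: "'a \<Rightarrow> 'b \<Rightarrow> 'c::{banach, second_countable_topology}"
  assumes f: "(\<lambda>(x, y). f x y) \<in> borel_measurable (M \<Otimes>\<^sub>M N)"
    and L: "L \<in> M \<rightarrow>\<^sub>M subprob_algebra N"
  shows "(\<lambda>x. \<integral>y. f x y \<partial>L x) \<in> borel_measurable M"
proof -
  note [measurable] = f L
  have "(\<lambda>x. distr (L x) (M \<Otimes>\<^sub>M N) (\<lambda>y. (x, y))) \<in> M \<rightarrow>\<^sub>M subprob_algebra (M \<Otimes>\<^sub>M N)"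
    by (rule measurable_distr2[OF _ L]) simp
  then have "(\<lambda>x. \<integral>z. (\<lambda>(x, y). f x y) z \<partial>distr (L x) (M \<Otimes>\<^sub>M N) (\<lambda>y. (x, y))) \<in> borel_measurable M"
    by (rule measurable_compose) (rule integral_measurable_subprob_algebra[OF f])
  moreover have "(\<integral>z. (\<lambda>(x, y). f x y) z \<partial>distr (L x) (M \<Otimes>\<^sub>M N) (\<lambda>y. (x, y))) = (\<integral>y. f x y \<partial>L x)"
    if x: "x \<in> space M" for x
  proof -
    have "sets (L x) = sets N"
      using measurable_space[OF L x] by (simp add: space_subprob_algebra)
    then have "(\<lambda>y. (x, y)) \<in> L x \<rightarrow>\<^sub>M M \<Otimes>\<^sub>M N"
      using measurable_Pair1'[OF x, of N] by (simp cong: measurable_cong_sets)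
    then show ?thesis
      by (subst integral_distr[OF _ f]) simp_all
  qed
  ultimately show ?thesis
    by (simp cong: measurable_cong)
qed

text \<open>The pair \<open>(S, g)\<close> is the parameter and \<open>T\<close> the integration
  variable: the integrand depends on \<open>S\<close> and \<open>T\<close>, and the law of
  \<open>T\<close> on \<open>g\<close> through the product kernel.\<close>

lemma empirical_risk_measurable:
  fixes F :: "('x::topological_space \<Rightarrow> real) set"
  assumes ipm: "(\<lambda>(S, T). ipm F (empirical_measure n S) (empirical_measure n T))
         \<in> borel_measurable (Pi\<^sub>M {..<n} (\<lambda>_. borel) \<Otimes>\<^sub>M Pi\<^sub>M {..<n} (\<lambda>_. borel))"
    and kernel: "Q \<in> G \<rightarrow>\<^sub>M prob_algebra borel"
  shows "(\<lambda>(S, g). empirical_risk F n S (Q g)) \<in> borel_measurable (Pi\<^sub>M {..<n} (\<lambda>_. borel) \<Otimes>\<^sub>M G)"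
proof -
  let ?P = "Pi\<^sub>M {..<n} (\<lambda>_. borel :: 'x measure)"
  note [measurable] = ipm
  have L: "(\<lambda>g. Pi\<^sub>M {..<n} (\<lambda>_. Q g)) \<in> G \<rightarrow>\<^sub>M subprob_algebra ?P"
    by (intro measurable_prob_algebraD measurable_PiM_kernel kernel) simp
  have "(\<lambda>z. \<integral>T. ipm F (empirical_measure n (fst z)) (empirical_measure n T)
            \<partial>Pi\<^sub>M {..<n} (\<lambda>_. Q (snd z))) \<in> borel_measurable (?P \<Otimes>\<^sub>M G)"
  proof (rule integral_measurable_subprob_algebra2[where N = ?P])
    show "(\<lambda>(z, T). ipm F (empirical_measure n (fst z)) (empirical_measure n T))
        \<in> borel_measurable ((?P \<Otimes>\<^sub>M G) \<Otimes>\<^sub>M ?P)"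
      using measurable_compose[of "\<lambda>w. (fst (fst w), snd w)" "(?P \<Otimes>\<^sub>M G) \<Otimes>\<^sub>M ?P" "?P \<Otimes>\<^sub>M ?P", OF _ ipm]
      by (simp add: case_prod_beta)
    show "(\<lambda>z. Pi\<^sub>M {..<n} (\<lambda>_. Q (snd z))) \<in> ?P \<Otimes>\<^sub>M G \<rightarrow>\<^sub>M subprob_algebra ?P"
      by (rule measurable_compose[OF measurable_snd L])
  qed
  then show ?thesis
    by (simp add: empirical_risk_def case_prod_beta)
qed

section \<open>The bounds for the empirical risk\<close>

text \<open>The first bound is stated in \<open>ereal\<close> to admit an infinite divergence; the
  second involves only pointwise values of the density and stays in the reals.\<close>

theorem theorem3p5:
  fixes F :: "('x::metric_space \<Rightarrow> real) set"
    and Pstar :: "'x measure"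
    and n :: nat
    and G :: "'g measure"
    and Pgen :: "'g \<Rightarrow> 'x measure"
    and \<pi> :: "'g measure"
    and lam \<delta> :: real
  assumes F_sym: "symmetric_class F"
    and F_bounded: "\<forall>f\<in>F. \<forall>x. f x \<in> {-1..1}"
    and F_measurable: "\<forall>f\<in>F. f \<in> borel_measurable borel"
    and Pstar: "prob_space Pstar" "sets Pstar = sets borel"
    and n: "1 \<le> n"
    and Pgen_kernel: "Pgen \<in> G \<rightarrow>\<^sub>M prob_algebra borel"
    and ipm_measurable:
      "(\<lambda>(S, T). ipm F (empirical_measure n S) (empirical_measure n T))
         \<in> borel_measurable (Pi\<^sub>M {..<n} (\<lambda>_. borel) \<Otimes>\<^sub>M Pi\<^sub>M {..<n} (\<lambda>_. borel))"
    and prior: "prob_space \<pi>" "sets \<pi> = sets G"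
    and lam: "0 < lam"
    and \<delta>: "0 < \<delta>" "\<delta> < 1"
  shows
    "(\<forall>\<rho>. prob_space \<rho> \<and> sets \<rho> = sets G \<and>
          absolutely_continuous \<pi> \<rho> \<and> absolutely_continuous \<rho> \<pi> \<longrightarrow>
        \<P>(S in Pi\<^sub>M {..<n} (\<lambda>_. Pstar).
          ereal ((\<integral>g. (\<integral>S'. empirical_risk F n S' (Pgen g) \<partial>(Pi\<^sub>M {..<n} (\<lambda>_. Pstar))) \<partial>\<rho>)
                 - (\<integral>g. empirical_risk F n S (Pgen g) \<partial>\<rho>))
          \<le> ereal (1 / lam) * (KL \<rho> \<pi> + ereal (ln (1 / \<delta>))) + ereal (4 * lam / real n))
        \<ge> 1 - \<delta>)
   \<and>
     (\<forall>\<rho>. prob_space \<rho> \<and> sets \<rho> = sets G \<and>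
          absolutely_continuous \<pi> \<rho> \<and> absolutely_continuous \<rho> \<pi> \<longrightarrow>
        \<P>((S, g) in Pi\<^sub>M {..<n} (\<lambda>_. Pstar) \<Otimes>\<^sub>M \<rho>.
          (\<integral>S'. empirical_risk F n S' (Pgen g) \<partial>(Pi\<^sub>M {..<n} (\<lambda>_. Pstar)))
            - empirical_risk F n S (Pgen g)
          \<le> 1 / lam * (ln (enn2real (RN_deriv \<pi> \<rho> g)) + ln (1 / \<delta>)) + 4 * lam / real n)
        \<ge> 1 - \<delta>)"
proof -
  interpret Pstar: prob_space Pstar by (rule Pstar(1))
  define \<mu> where "\<mu> = Pi\<^sub>M {..<n} (\<lambda>_. Pstar)"
  have \<mu>: "prob_space \<mu>"
    unfolding \<mu>_def by (intro prob_space_PiM Pstar(1))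
  interpret \<mu>: prob_space \<mu> by (rule \<mu>)
  have sets_\<mu>: "sets \<mu> = sets (Pi\<^sub>M {..<n} (\<lambda>_. borel))"
    unfolding \<mu>_def using Pstar(2) by (intro sets_PiM_cong) auto
  let ?D = "\<lambda>S T. ipm F (empirical_measure n S) (empirical_measure n T)"
  let ?R = "\<lambda>S g. empirical_risk F n S (Pgen g)"
  let ?P = "\<lambda>g. Pi\<^sub>M {..<n} (\<lambda>_. Pgen g)"
  define \<Delta> where "\<Delta> S g = (\<integral>S'. ?R S' g \<partial>\<mu>) - ?R S g" for S g
  have n0: "0 < n"
    using n by simp
  obtain B where B: "\<And>S T. \<bar>?D S T\<bar> \<le> B"
    using ipm_empirical_bounded[OF F_bounded F_measurable n0] by blast
  have R_measurable: "(\<lambda>(S, g). ?R S g) \<in> borel_measurable (\<mu> \<Otimes>\<^sub>M G)"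
    using empirical_risk_measurable[OF ipm_measurable Pgen_kernel] sets_\<mu>
    by (simp cong: measurable_cong_sets sets_pair_measure_cong)
  have P: "prob_space (?P g)" "sets (?P g) = sets (Pi\<^sub>M {..<n} (\<lambda>_. borel))" if "g \<in> space G" for g
    using measurable_space[OF Pgen_kernel that]
    by (auto simp: space_prob_algebra intro!: prob_space_PiM sets_PiM_cong)
  have D_integrable: "integrable (?P g) (?D S)" if S: "S \<in> space \<mu>" and g: "g \<in> space G" for S g
  proof -
    interpret Pg: prob_space "?P g" by (rule P[OF g])
    have "S \<in> space (Pi\<^sub>M {..<n} (\<lambda>_. borel))"
      using S sets_eq_imp_space_eq[OF sets_\<mu>] by simp
    then have "?D S \<in> borel_measurable (Pi\<^sub>M {..<n} (\<lambda>_. borel))"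
      using measurable_compose[OF measurable_Pair1' ipm_measurable] by simp
    then have "?D S \<in> borel_measurable (?P g)"
      using P(2)[OF g] by (simp cong: measurable_cong_sets)
    then show ?thesis
      using B by (intro Pg.integrable_const_bound[where B = B]) auto
  qed
  have R_bound: "\<bar>?R S g\<bar> \<le> B" if S: "S \<in> space \<mu>" and g: "g \<in> space G" for S g
  proof -
    interpret Pg: prob_space "?P g" by (rule P[OF g])
    have "\<bar>?R S g\<bar> \<le> (\<integral>T. \<bar>?D S T\<bar> \<partial>?P g)"
      unfolding empirical_risk_def by (rule integral_abs_bound)
    also have "\<dots> \<le> (\<integral>T. B \<partial>?P g)"
      using D_integrable[OF S g] B by (intro integral_mono) auto
    finally show ?thesis
      by (simp add: Pg.prob_space)
  qed
  have R_diff: "\<bar>?R (S(i := y)) g - ?R S g\<bar> \<le> 2 / real n"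
    if S: "S \<in> space \<mu>" and i: "i \<in> {..<n}" and y: "y \<in> space Pstar" and g: "g \<in> space G" for S i y g
  proof -
    interpret Pg: prob_space "?P g" by (rule P[OF g])
    have S': "S(i := y) \<in> space \<mu>"
      using PiE_fun_upd[of y "\<lambda>_. space Pstar" i S "{..<n}"] S i y
      by (simp add: \<mu>_def space_PiM insert_absorb)
    \<comment> \<open>Both risks integrate over the same generated sample \<open>T\<close>, so the
      pointwise estimate 2 / n survives the expectation.\<close>
    have "?R (S(i := y)) g - ?R S g = (\<integral>T. ?D (S(i := y)) T - ?D S T \<partial>?P g)"
      unfolding empirical_risk_def using D_integrable[OF S g] D_integrable[OF S' g] by simp
    also have "\<bar>\<dots>\<bar> \<le> (\<integral>T. \<bar>?D (S(i := y)) T - ?D S T\<bar> \<partial>?P g)"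
      by (rule integral_abs_bound)
    also have "\<dots> \<le> (\<integral>T. 2 / real n \<partial>?P g)"
      using D_integrable[OF S g] D_integrable[OF S' g]
      by (intro integral_mono ipm_empirical_update[OF F_bounded F_measurable n0]) auto
    finally show ?thesis
      by (simp add: Pg.prob_space)
  qed
  have R_section: "(\<lambda>S. ?R S g) \<in> borel_measurable \<mu>" if "g \<in> space G" for g
    using measurable_compose[OF measurable_Pair2'[OF that] R_measurable] by simp
  have mgf: "(\<integral>\<^sup>+S. exp (lam * \<Delta> S g) \<partial>\<mu>) \<le> exp (4 * lam\<^sup>2 / real n)" if g: "g \<in> space G" for g
  proof -
    \<comment> \<open>The bounded-difference estimate is applied to the negated risk, whose
      deviation from its mean is exactly \<Delta>.\<close>
    have "(\<integral>\<^sup>+S. exp (lam * (- ?R S g - (\<integral>S. - ?R S g \<partial>\<mu>))) \<partial>\<mu>)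
        \<le> exp (lam\<^sup>2 * (\<Sum>i<n. (2 / real n)\<^sup>2) / 8)"
      unfolding \<mu>_def
    proof (rule mcdiarmid_mgf)
      show "(\<lambda>S. - ?R S g) \<in> borel_measurable (Pi\<^sub>M {..<n} (\<lambda>_. Pstar))"
        using R_section[OF g] unfolding \<mu>_def by simp
      show "\<bar>- ?R S g\<bar> \<le> B" if "S \<in> space (Pi\<^sub>M {..<n} (\<lambda>_. Pstar))" for S
        using R_bound[OF _ g] that unfolding \<mu>_def by simp
      show "\<bar>- ?R (S(i := y)) g - - ?R S g\<bar> \<le> 2 / real n"
        if "S \<in> space (Pi\<^sub>M {..<n} (\<lambda>_. Pstar))" "i \<in> {..<n}" "y \<in> space Pstar" for S i y
        using R_diff[of S i y g] that g unfolding \<mu>_def by linarith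
    qed (use Pstar(1) lam in auto)
    \<comment> \<open>The sum equals 4 / n, so the exponent is lam^2 / (2 n), which is then enlarged
      to the constant of the statement.\<close>
    also have "lam\<^sup>2 * (\<Sum>i<n. (2 / real n)\<^sup>2) / 8 \<le> 4 * lam\<^sup>2 / real n"
      using n0 by (simp add: field_simps power2_eq_square)
    finally show ?thesis
      by (simp add: \<Delta>_def)
  qed
  have K: "4 * lam\<^sup>2 / real n / lam = 4 * lam / real n"
    using lam by (simp add: power2_eq_square)
  have \<Delta>_measurable: "(\<lambda>(S, g). \<Delta> S g) \<in> borel_measurable (\<mu> \<Otimes>\<^sub>M G)"
  proof -
    note [measurable] = R_measurable
    have [measurable]: "(\<lambda>g. \<integral>S. ?R S g \<partial>\<mu>) \<in> borel_measurable G"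
      by (intro \<mu>.borel_measurable_lebesgue_integral) measurable
    show ?thesis
      unfolding \<Delta>_def by measurable
  qed
  have mean_bound: "\<bar>\<integral>S. ?R S g \<partial>\<mu>\<bar> \<le> B" if g: "g \<in> space G" for g
  proof -
    have "integrable \<mu> (\<lambda>S. ?R S g)"
      using R_section[OF g] R_bound[OF _ g] by (intro \<mu>.integrable_const_bound[where B = B]) auto
    then have "(\<integral>S. \<bar>?R S g\<bar> \<partial>\<mu>) \<le> (\<integral>S. B \<partial>\<mu>)"
      using R_bound[OF _ g] by (intro integral_mono) auto
    also have "\<dots> = B"
      by (simp add: \<mu>.prob_space)
    finally show ?thesis
      by (rule order.trans[OF integral_abs_bound])
  qed
  have \<Delta>_bound: "\<bar>\<Delta> S g\<bar> \<le> 2 * B" if "S \<in> space \<mu>" "g \<in> space G" for S g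
    using R_bound[OF that] mean_bound[OF that(2)] unfolding \<Delta>_def by linarith
  show ?thesis
    unfolding \<mu>_def[symmetric]
  \<comment> \<open>Both conjuncts quantify over \<rho> under the same assumptions, so a single
    block settles both.\<close>
  proof (intro conjI allI impI; elim conjE)
    fix \<rho> :: "'g measure"
    assume \<rho>: "prob_space \<rho>" "sets \<rho> = sets G" and ac: "absolutely_continuous \<pi> \<rho>"
    interpret \<rho>: prob_space \<rho> by (rule \<rho>)
    have space_\<rho>: "space \<rho> = space G"
      by (rule sets_eq_imp_space_eq[OF \<rho>(2)])
    have sets_eq: "sets \<rho> = sets \<pi>"
      using \<rho>(2) prior(2) by simp
    have \<Delta>_measurable': "(\<lambda>(S, g). \<Delta> S g) \<in> borel_measurable (\<mu> \<Otimes>\<^sub>M \<rho>)"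
      using \<Delta>_measurable \<rho>(2) by (simp cong: measurable_cong_sets sets_pair_measure_cong)
    note pac_bayes = \<mu> prior(1) \<rho>(1) sets_eq ac \<Delta>_measurable' lam \<delta>(1) mgf[folded space_\<rho>]
    show "1 - \<delta> \<le> \<P>((S, g) in \<mu> \<Otimes>\<^sub>M \<rho>. (\<integral>S'. ?R S' g \<partial>\<mu>) - ?R S g
        \<le> 1 / lam * (ln (enn2real (RN_deriv \<pi> \<rho> g)) + ln (1 / \<delta>)) + 4 * lam / real n)"
      using pac_bayes_disintegrated[OF pac_bayes] unfolding K \<Delta>_def .
    \<comment> \<open>The statement has a difference of two integrals over \<rho>, while
      \<open>pac_bayes_expected\<close> has the integral of a difference. Integrability of both
      terms identifies the two.\<close>
    have R_integrable: "integrable \<rho> (?R S)" if S: "S \<in> space \<mu>" for S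
    proof (rule \<rho>.integrable_const_bound[where B = B])
      have "?R S \<in> borel_measurable G"
        using measurable_compose[OF measurable_Pair1'[OF S] R_measurable] by simp
      then show "?R S \<in> borel_measurable \<rho>"
        using \<rho>(2) by (simp cong: measurable_cong_sets)
    qed (use R_bound[OF S] space_\<rho> in auto)
    have mean_integrable: "integrable \<rho> (\<lambda>g. \<integral>S. ?R S g \<partial>\<mu>)"
    proof (rule \<rho>.integrable_const_bound[where B = B])
      note [measurable] = R_measurable
      have "(\<lambda>g. \<integral>S. ?R S g \<partial>\<mu>) \<in> borel_measurable G"
        by (intro \<mu>.borel_measurable_lebesgue_integral) measurable
      then show "(\<lambda>g. \<integral>S. ?R S g \<partial>\<mu>) \<in> borel_measurable \<rho>"
        using \<rho>(2) by (simp cong: measurable_cong_sets)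
    qed (use mean_bound space_\<rho> in auto)
    have "1 - \<delta> \<le> \<P>(S in \<mu>. ereal (\<integral>g. \<Delta> S g \<partial>\<rho>)
        \<le> ereal (1 / lam) * (KL \<rho> \<pi> + ereal (ln (1 / \<delta>))) + ereal (4 * lam / real n))"
      using pac_bayes_expected[OF pac_bayes \<Delta>_bound[folded space_\<rho>]] unfolding K .
    also have "{S \<in> space \<mu>. ereal (\<integral>g. \<Delta> S g \<partial>\<rho>)
          \<le> ereal (1 / lam) * (KL \<rho> \<pi> + ereal (ln (1 / \<delta>))) + ereal (4 * lam / real n)}
      = {S \<in> space \<mu>. ereal ((\<integral>g. (\<integral>S'. ?R S' g \<partial>\<mu>) \<partial>\<rho>) - (\<integral>g. ?R S g \<partial>\<rho>))
          \<le> ereal (1 / lam) * (KL \<rho> \<pi> + ereal (ln (1 / \<delta>))) + ereal (4 * lam / real n)}"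
      unfolding \<Delta>_def using R_integrable mean_integrable by (intro Collect_cong conj_cong refl) simp
    finally show "1 - \<delta> \<le> \<P>(S in \<mu>. ereal ((\<integral>g. (\<integral>S'. ?R S' g \<partial>\<mu>) \<partial>\<rho>) - (\<integral>g. ?R S g \<partial>\<rho>))
          \<le> ereal (1 / lam) * (KL \<rho> \<pi> + ereal (ln (1 / \<delta>))) + ereal (4 * lam / real n))" .
  qed
qed

end
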